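(* A geometric Apollonian circle packing is strongly integral if and only if it contains three mutually tangent circles each of which has integer curvature-center coordinates.
   Context: Circles are taken in $\hat{\mathbb C}=\mathbb R^2\cup\{\infty\}$; lines count as circles. A Descartes configuration is a set of four mutually tangent circles with disjoint interiors; signed curvatures are reciprocal radii, negative for a circle whose interior is unbounded, $0$ for lines. The curvature-center coordinates of a circle with signed curvature $b$ and center $(x,y)$ are $(b,bx,by)$; for a line they are $(0,n_x,n_y)$ with $n$ the unit normal pointing into its interior half-plane; the curvature-center coordinate matrix $M_{\mathcal D}$ of an ordered Descartes configuration has these as its rows. Let $S_i$ be the $4\times4$ integer matrix equal to the identity except that row $i$ has $-1$ in position $i$ and $2$ elsewhere; the Apollonian group $\mathcal A=\langle S_1,\dots,S_4\rangle$ acts on ordered oriented Descartes configurations with $M_{U[\mathcal D]}=UM_{\mathcal D}$ ($S_i$ replaces the $i$-th circle by the other circle tangent to the remaining three). The geometric Apollonian packing generated by $\mathcal D$ is the set of circles of configurations in $\mathcal A[\mathcal D]$; it is strongly integral if $M_{\mathcal D'}$ is an integer matrix for some (equivalently every) configuration $\mathcal D'$ in $\mathcal A[\mathcal D]$. *)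

theory Defs
  imports "HOL-Analysis.Analysis" "HOL-Library.Numeral_Type"
begin

text \<open>Oriented generalized circles in the extended plane, with the plane identified
with the complex numbers.
  Circ z b : circle with centre z and signed curvature b (b \<noteq> 0), radius 1/|b|;
             interior is the open disk if b > 0 and the open exterior if b < 0.
  Line n d : line {p. n \<bullet> p = d} with unit normal n pointing into its interior
             half-plane {p. n \<bullet> p > d}.\<close>

datatype ocircle = Circ complex real | Line complex real

fun wf_circle :: "ocircle \<Rightarrow> bool" where
  "wf_circle (Circ z b) \<longleftrightarrow> b \<noteq> 0"
| "wf_circle (Line n d) \<longleftrightarrow> norm n = 1"

fun cinterior :: "ocircle \<Rightarrow> complex set" where
  "cinterior (Circ z b) = (if b > 0 then ball z (1 / b) else - cball z (1 / \<bar>b\<bar>))"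
| "cinterior (Line n d) = {p. n \<bullet> p > d}"

text \<open>Points of the extended plane: Some p for p in the plane, None for infinity.\<close>
fun cboundary :: "ocircle \<Rightarrow> complex option set" where
  "cboundary (Circ z b) = Some ` sphere z (1 / \<bar>b\<bar>)"
| "cboundary (Line n d) = insert None (Some ` {p. n \<bullet> p = d})"

definition tangent :: "ocircle \<Rightarrow> ocircle \<Rightarrow> bool" where
  "tangent C D \<longleftrightarrow> (\<exists>!p. p \<in> cboundary C \<and> p \<in> cboundary D)"

definition descartes :: "(4 \<Rightarrow> ocircle) \<Rightarrow> bool" where
  "descartes D \<longleftrightarrow> (\<forall>i. wf_circle (D i)) \<and>
     (\<forall>i j. i \<noteq> j \<longrightarrow> tangent (D i) (D j) \<and> cinterior (D i) \<inter> cinterior (D j) = {})"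

fun ccc :: "ocircle \<Rightarrow> real \<times> real \<times> real" where
  "ccc (Circ z b) = (b, b * Re z, b * Im z)"
| "ccc (Line n d) = (0, Re n, Im n)"

definition integral_ccc :: "ocircle \<Rightarrow> bool" where
  "integral_ccc C \<longleftrightarrow> (case ccc C of (a, b, c) \<Rightarrow> a \<in> \<int> \<and> b \<in> \<int> \<and> c \<in> \<int>)"

definition apollo_move :: "4 \<Rightarrow> (4 \<Rightarrow> ocircle) \<Rightarrow> (4 \<Rightarrow> ocircle)" where
  "apollo_move i D = D(i := (THE c. c \<noteq> D i \<and> descartes (D(i := c))))"

text \<open>The orbit A[D] of D under the Apollonian group generated by S_1..S_4
(the generators are involutions, so the orbit is the closure under the moves).\<close>
inductive_set apollo_orbit :: "(4 \<Rightarrow> ocircle) \<Rightarrow> (4 \<Rightarrow> ocircle) set" for D where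
  base: "D \<in> apollo_orbit D"
| step: "D' \<in> apollo_orbit D \<Longrightarrow> apollo_move i D' \<in> apollo_orbit D"

definition apollo_packing :: "(4 \<Rightarrow> ocircle) \<Rightarrow> ocircle set" where
  "apollo_packing D = {D' i | D' i. D' \<in> apollo_orbit D}"

definition strongly_integral :: "(4 \<Rightarrow> ocircle) \<Rightarrow> bool" where
  "strongly_integral D \<longleftrightarrow> (\<exists>D' \<in> apollo_orbit D. \<forall>i. integral_ccc (D' i))"

end

theory Submission
  imports Defs
begin

text \<open>An oriented circle is a vector of norm 1 in a space with a quadratic form of signature (3,1); a
  Descartes configuration is a basis of this space with Gram matrix \<open>2 I - J\<close>, and a move replaces
  one vector by its reflection in a wall of the configuration.

  Three mutually tangent circles of the packing lie in one configuration of the orbit: along a word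
  without immediate repetitions, the products of a fixed circle of the initial configuration with the
  current one only decrease, and a product \<open>-1\<close> with a newly created circle forces the fixed circle
  to be in the current configuration.

  Let \<open>w\<^sub>4 = w\<^sub>1 + w\<^sub>2 + w\<^sub>3 + 2 u\<close> be the fourth circle. The Descartes relations show that the
  squares and the doubled products of the coordinates \<open>\<beta>, \<xi>, \<eta>\<close> of \<open>u\<close> are integers, and that
  \<open>2 \<beta>\<close> is up to sign the determinant of the three integral coordinate vectors. Hence \<open>\<beta>\<close> is
  an integer, and so are \<open>\<xi>\<close> and \<open>\<eta>\<close>; if \<open>\<beta> = 0\<close> this holds because \<open>\<xi>\<^sup>2 + \<eta>\<^sup>2 = 1\<close>.\<close>

section \<open>Circles as vectors\<close>

definition vec4 :: "real \<Rightarrow> real \<Rightarrow> real \<Rightarrow> real \<Rightarrow> real^4" where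
  "vec4 a b c d = (\<chi> i. if i = 1 then a else if i = 2 then b else if i = 3 then c else d)"

lemma vec4_nth [simp]:
  "vec4 a b c d $ 1 = a" "vec4 a b c d $ 2 = b" "vec4 a b c d $ 3 = c" "vec4 a b c d $ 4 = d"
  by (simp_all add: vec4_def)

lemma vec4_eq_iff:
  fixes u v :: "real^4"
  shows "u = v \<longleftrightarrow> u$1 = v$1 \<and> u$2 = v$2 \<and> u$3 = v$3 \<and> u$4 = v$4"
  by (simp add: vec_eq_iff forall_4)

text \<open>The polar form of \<open>u$3^2 + u$4^2 - u$1 * u$2\<close>, of signature (3,1).\<close>

definition lor :: "real^4 \<Rightarrow> real^4 \<Rightarrow> real" where
  "lor u v = u$3 * v$3 + u$4 * v$4 - (u$1 * v$2 + u$2 * v$1) / 2"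

interpretation lor: bounded_bilinear lor
  unfolding bilinear_conv_bounded_bilinear[symmetric] bilinear_def
  by (auto intro!: linearI simp: lor_def algebra_simps add_divide_distrib)

lemmas lor_simps = lor.add_left lor.add_right lor.diff_left lor.diff_right
  lor.scaleR_left lor.scaleR_right lor.minus_left lor.minus_right real_scaleR_def

lemma lor_commute: "lor u v = lor v u"
  by (simp add: lor_def algebra_simps)

text \<open>The curvature-center coordinates are preceded by the curvature of the image under inversion in
  the unit circle.\<close>
fun cvec :: "ocircle \<Rightarrow> real^4" where
  "cvec (Circ z b) = vec4 (b * (norm z)\<^sup>2 - 1 / b) b (b * Re z) (b * Im z)"
| "cvec (Line n d) = vec4 (2 * d) 0 (Re n) (Im n)"

text \<open>The points of the extended plane are the null lines of \<open>lor\<close>; a point lies on an oriented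
  circle, or in its interior, iff the product of the two vectors is zero, or positive.\<close>
fun lift :: "complex option \<Rightarrow> real^4" where
  "lift None = vec4 1 0 0 0"
| "lift (Some p) = vec4 ((norm p)\<^sup>2) 1 (Re p) (Im p)"

lemma norm_one_iff: "norm (n::complex) = 1 \<longleftrightarrow> (Re n)\<^sup>2 + (Im n)\<^sup>2 = 1"
  by (simp add: cmod_def)

lemma cmod_sq:
  "(norm (z::complex))\<^sup>2 = Re z * Re z + Im z * Im z" "norm z * norm z = Re z * Re z + Im z * Im z"
  using cmod_power2[of z] by (simp_all add: power2_eq_square)

lemma lor_cvec_self: "wf_circle C \<Longrightarrow> lor (cvec C) (cvec C) = 1"
  by (cases C) (auto simp: lor_def norm_one_iff cmod_sq field_simps power2_eq_square)

lemma cvec_inj: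
  assumes "wf_circle C" "wf_circle C'" "cvec C = cvec C'"
  shows "C = C'"
  using assms by (cases C; cases C') (auto simp: vec4_eq_iff complex_eq_iff)

lemma cvec_surj:
  assumes "lor v v = 1"
  obtains C where "wf_circle C" "cvec C = v"
proof (cases "v$2 = 0")
  case True
  then have "wf_circle (Line (Complex (v$3) (v$4)) (v$1 / 2))"
    using assms by (simp add: lor_def norm_one_iff power2_eq_square)
  moreover have "cvec (Line (Complex (v$3) (v$4)) (v$1 / 2)) = v"
    using True by (simp add: vec4_eq_iff)
  ultimately show ?thesis by (rule that)
next
  case False
  then have "wf_circle (Circ (Complex (v$3 / v$2) (v$4 / v$2)) (v$2))" by simp
  moreover have "cvec (Circ (Complex (v$3 / v$2) (v$4 / v$2)) (v$2)) = v"
    using False assms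
    by (simp add: vec4_eq_iff lor_def cmod_sq field_simps power2_eq_square)
  ultimately show ?thesis by (rule that)
qed

section \<open>Points of the extended plane as null vectors\<close>

lemma lift_lift:
  shows "lor (lift P) (lift P) = 0" "P \<noteq> Q \<Longrightarrow> lor (lift P) (lift Q) < 0"
proof -
  show "lor (lift P) (lift P) = 0"
    by (cases P) (simp_all add: lor_def cmod_sq)
  have *: "lor (lift (Some p)) (lift (Some q)) = - (norm (p - q))\<^sup>2 / 2" for p q
    by (simp add: lor_def cmod_sq power2_eq_square algebra_simps add_divide_distrib diff_divide_distrib)
  show "lor (lift P) (lift Q) < 0" if "P \<noteq> Q"
  proof (cases P; cases Q)
    fix p q assume "P = Some p" "Q = Some q"
    with that show ?thesis unfolding \<open>P = _\<close> \<open>Q = _\<close> * by simp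
  qed (use that in \<open>auto simp: lor_def\<close>)
qed

lemma lor_lift_nonpos: "lor (lift P) (lift Q) \<le> 0"
  by (cases "P = Q") (simp_all add: lift_lift less_imp_le)

text \<open>\<open>u$1 + u$2\<close> is a time coordinate: its sign tells the two halves of the
  light cone apart.\<close>

lemma lift_time_pos: "lift P $ 1 + lift P $ 2 > 0"
  by (cases P) (auto intro: add_nonneg_pos)

lemma null_eq_lift:
  assumes "lor u u = 0" "u \<noteq> 0"
  obtains r P where "r \<noteq> 0" "u = r *\<^sub>R lift P"
proof (cases "u$2 = 0")
  case True
  then have "(u$3)\<^sup>2 + (u$4)\<^sup>2 = 0" using assms by (simp add: lor_def power2_eq_square)
  then have "u$3 = 0" "u$4 = 0" by (auto simp: sum_power2_eq_zero_iff)
  then have "u = u$1 *\<^sub>R lift None" using True by (simp add: vec4_eq_iff)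
  with assms show ?thesis by (intro that[of "u$1" None]) auto
next
  case False
  then have "u = u$2 *\<^sub>R lift (Some (Complex (u$3 / u$2) (u$4 / u$2)))"
    using assms(1)
    by (simp add: vec4_eq_iff lor_def cmod_sq field_simps power2_eq_square)
  with False show ?thesis by (rule that)
qed

lemma norm_eq_inverse_iff:
  fixes w :: complex
  assumes "b \<noteq> 0"
  shows "norm w = 1 / \<bar>b\<bar> \<longleftrightarrow> (norm w)\<^sup>2 = 1 / b\<^sup>2" "norm w < 1 / \<bar>b\<bar> \<longleftrightarrow> (norm w)\<^sup>2 < 1 / b\<^sup>2"
proof -
  have "1 / b\<^sup>2 = (1 / \<bar>b\<bar>)\<^sup>2" by (simp add: power_divide)
  then show "norm w = 1 / \<bar>b\<bar> \<longleftrightarrow> (norm w)\<^sup>2 = 1 / b\<^sup>2" "norm w < 1 / \<bar>b\<bar> \<longleftrightarrow> (norm w)\<^sup>2 < 1 / b\<^sup>2"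
    by (auto simp: power2_eq_iff_nonneg intro: power_strict_mono power_less_imp_less_base)
qed

text \<open>Up to the factor \<open>- b / 2\<close> this is the power of \<open>p\<close> with
  respect to the circle; the sign of \<open>b\<close> brings in the orientation.\<close>

lemma lor_Circ_lift:
  assumes "b \<noteq> 0"
  shows "lor (cvec (Circ z b)) (lift (Some p)) = b / 2 * (1 / b\<^sup>2 - (norm (z - p))\<^sup>2)"
  using assms by (simp add: lor_def cmod_sq field_simps power2_eq_square)

lemma lor_Line_lift: "lor (cvec (Line n d)) (lift (Some p)) = n \<bullet> p - d"
  by (simp add: lor_def inner_complex_def)

lemma mem_cboundary_iff:
  assumes "wf_circle C"
  shows "P \<in> cboundary C \<longleftrightarrow> lor (cvec C) (lift P) = 0"
proof (cases P)
  case None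
  then show ?thesis using assms by (cases C) (auto simp: lor_def)
next
  case (Some p)
  show ?thesis
  proof (cases C)
    case (Circ z b)
    with assms have "b \<noteq> 0" by simp
    then show ?thesis
      unfolding Circ Some lor_Circ_lift[OF \<open>b \<noteq> 0\<close>]
      by (auto simp: dist_norm norm_eq_inverse_iff)
  next
    case (Line n d)
    show ?thesis unfolding Line Some lor_Line_lift by auto
  qed
qed

lemma mem_cinterior_iff:
  assumes "wf_circle C"
  shows "p \<in> cinterior C \<longleftrightarrow> lor (cvec C) (lift (Some p)) > 0"
proof (cases C)
  case (Circ z b)
  with assms have b: "b \<noteq> 0" by simp
  have "norm (z - p) \<le> 1 / \<bar>b\<bar> \<longleftrightarrow> (norm (z - p))\<^sup>2 \<le> 1 / b\<^sup>2"
    using norm_eq_inverse_iff[OF b, of "z - p"] by (auto simp: le_less)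
  then show ?thesis
    unfolding Circ lor_Circ_lift[OF b] zero_less_mult_iff
    using b norm_eq_inverse_iff(2)[OF b, of "z - p"] by (auto simp: dist_norm)
next
  case (Line n d)
  show ?thesis unfolding Line lor_Line_lift by auto
qed

lemma two_finite_boundary_points:
  assumes "wf_circle C"
  obtains p q where "p \<noteq> q" "Some p \<in> cboundary C" "Some q \<in> cboundary C"
proof (cases C)
  case (Circ z b)
  with assms have "b \<noteq> 0" by simp
  then show ?thesis
    by (intro that[of "z + of_real (1 / \<bar>b\<bar>)" "z - of_real (1 / \<bar>b\<bar>)"])
      (auto simp: Circ dist_norm complex_eq_iff norm_divide)
next
  case (Line n d)
  then have "n \<bullet> n = 1" "n \<noteq> 0" using assms by (auto simp: dot_square_norm)
  moreover have "n \<bullet> (\<i> * n) = 0" by (simp add: inner_complex_def)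
  ultimately show ?thesis
    by (intro that[of "d *\<^sub>R n" "d *\<^sub>R n + \<i> * n"]) (auto simp: Line inner_add_right)
qed

lemma cinterior_nonempty:
  assumes "wf_circle C"
  shows "cinterior C \<noteq> {}"
proof (cases C)
  case (Circ z b)
  show ?thesis
  proof (cases "b > 0")
    case True
    then show ?thesis by (auto simp: Circ)
  next
    case False
    then have "z + of_real (2 / \<bar>b\<bar>) \<in> cinterior C"
      using assms by (auto simp: Circ dist_norm norm_divide field_simps)
    then show ?thesis by blast
  qed
next
  case (Line n d)
  then have "n \<bullet> n = 1" using assms by (auto simp: dot_square_norm)
  then have "(d + 1) *\<^sub>R n \<in> cinterior C" by (simp add: Line)
  then show ?thesis by blast
qed

section \<open>Tangency of two circles\<close>

lemma not_tangent_self: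
  assumes "wf_circle C"
  shows "\<not> tangent C C"
  using two_finite_boundary_points[OF assms] unfolding tangent_def by (metis option.inject)

text \<open>If the product differs from \<open>\<plusminus>1\<close>, then \<open>cvec C\<close> and \<open>cvec C'\<close> span a nondegenerate plane,
  and a null direction in its orthogonal complement is accompanied by a second one.\<close>
lemma tangent_imp_lor_sq:
  assumes wf: "wf_circle C" "wf_circle C'" and tan: "tangent C C'"
  shows "(lor (cvec C) (cvec C'))\<^sup>2 = 1"
proof (rule ccontr)
  define w w' c where "w = cvec C" and "w' = cvec C'" and "c = lor w w'"
  assume "(lor (cvec C) (cvec C'))\<^sup>2 \<noteq> 1"
  then have c: "1 - c\<^sup>2 \<noteq> 0" by (simp add: c_def w_def w'_def)
  from tan obtain P where P: "P \<in> cboundary C" "P \<in> cboundary C'"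
    and uniq: "\<And>Q. Q \<in> cboundary C \<Longrightarrow> Q \<in> cboundary C' \<Longrightarrow> Q = P"
    unfolding tangent_def by blast
  have ww: "lor w w = 1" "lor w' w' = 1" "lor w w' = c" "lor w' w = c"
    using wf by (simp_all add: lor_cvec_self w_def w'_def c_def lor_commute)
  have wP: "lor w (lift P) = 0" "lor w' (lift P) = 0"
    using P wf by (simp_all add: mem_cboundary_iff w_def w'_def)
  define t where "t = vec4 1 1 0 0"
  have tP: "lor t (lift P) \<noteq> 0" using lift_time_pos[of P] by (simp add: lor_def t_def add.commute)
  from c obtain k where k: "k * (1 - c\<^sup>2) = 1" by (metis nonzero_divide_eq_eq)
  \<comment> \<open>The projection of the timelike \<open>t\<close> to the orthogonal complement of
    \<open>w\<close> and \<open>w'\<close>; \<open>k\<close> inverts the Gram determinant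
    \<open>1 - c\<^sup>2\<close>.\<close>
  define v where "v = t - (k * (lor w t - c * lor w' t)) *\<^sub>R w - (k * (lor w' t - c * lor w t)) *\<^sub>R w'"
  have wv: "lor w v = 0" unfolding v_def lor_simps ww using k by algebra
  have wv': "lor w' v = 0" unfolding v_def lor_simps ww using k by algebra
  have vP: "lor v (lift P) = lor t (lift P)" by (simp add: v_def lor_simps wP)
  \<comment> \<open>The second null direction: the multiple of \<open>lift P\<close> is chosen to
    cancel \<open>lor v v\<close>.\<close>
  define u where "u = v - (lor v v / (2 * lor t (lift P))) *\<^sub>R lift P"
  have "lor u u = 0"
    using tP by (simp add: u_def lor_simps lift_lift vP lor_commute[of "lift P" v])
  moreover have uP: "lor u (lift P) \<noteq> 0"
    using tP by (simp add: u_def lor_simps lift_lift vP)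
  moreover from uP have "u \<noteq> 0" by (auto simp: lor.zero_left)
  ultimately obtain r Q where r: "r \<noteq> 0" and u: "u = r *\<^sub>R lift Q" by (metis null_eq_lift)
  have "lor w u = 0" "lor w' u = 0" by (simp_all add: u_def lor_simps wv wv' wP)
  then have "Q \<in> cboundary C" "Q \<in> cboundary C'"
    using r wf by (simp_all add: u lor_simps mem_cboundary_iff w_def w'_def)
  then have "Q = P" by (rule uniq)
  with uP show False by (simp add: u lor_simps lift_lift)
qed

text \<open>A product \<open>-1\<close> alone does not suffice: the interiors may also cover the plane, or be the two sides
  of one circle. The positivity condition excludes both.\<close>
lemma tangent_disjoint_iff:
  assumes wf: "wf_circle C" "wf_circle C'"
  shows "tangent C C' \<and> cinterior C \<inter> cinterior C' = {} \<longleftrightarrow>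
    lor (cvec C) (cvec C') = -1 \<and> (cvec C + cvec C') $ 1 + (cvec C + cvec C') $ 2 > 0"
    (is "?L \<longleftrightarrow> ?R")
proof
  define w w' where "w = cvec C" and "w' = cvec C'"
  have ww: "lor w w = 1" "lor w' w' = 1" using wf by (simp_all add: lor_cvec_self w_def w'_def)
  have int: "p \<in> cinterior C \<longleftrightarrow> lor w (lift (Some p)) > 0"
    "p \<in> cinterior C' \<longleftrightarrow> lor w' (lift (Some p)) > 0" for p
    using wf by (simp_all add: mem_cinterior_iff w_def w'_def)
  have bd: "P \<in> cboundary C \<longleftrightarrow> lor w (lift P) = 0"
    "P \<in> cboundary C' \<longleftrightarrow> lor w' (lift P) = 0" for P
    using wf by (simp_all add: mem_cboundary_iff w_def w'_def)
  {
    assume ?L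
    then have tan: "tangent C C'" and disj: "\<And>p. p \<in> cinterior C \<Longrightarrow> p \<in> cinterior C' \<Longrightarrow> False" by auto
    have "lor w w' \<noteq> 1"
    proof
      assume 1: "lor w w' = 1"
      \<comment> \<open>\<open>w - w'\<close> is null, hence zero or a multiple of one lifted point,
        so its products with points never change sign.\<close>
      have sub: "cinterior C \<subseteq> cinterior C' \<or> cinterior C' \<subseteq> cinterior C"
      proof (cases "w - w' = 0")
        case True
        then show ?thesis using int by auto
      next
        case False
        moreover have "lor (w - w') (w - w') = 0"
          using 1 by (simp add: lor_simps ww lor_commute[of w' w])
        ultimately obtain r P where r: "r \<noteq> 0" and u: "w - w' = r *\<^sub>R lift P"
          by (metis null_eq_lift)
        have d: "lor w (lift Q) - lor w' (lift Q) = r * lor (lift P) (lift Q)" for Q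
          using arg_cong[OF u, of "\<lambda>x. lor x (lift Q)"] by (simp add: lor_simps)
        show ?thesis
        proof (cases "r > 0")
          case True
          then have "lor w (lift Q) \<le> lor w' (lift Q)" for Q
            using d[of Q] mult_nonneg_nonpos[OF _ lor_lift_nonpos, of r P Q] by linarith
          then show ?thesis using int by (meson less_le_trans subsetI)
        next
          case False
          then have "lor w' (lift Q) \<le> lor w (lift Q)" for Q
            using d[of Q] mult_nonpos_nonpos[OF _ lor_lift_nonpos, of r P Q] by linarith
          then show ?thesis using int by (meson less_le_trans subsetI)
        qed
      qed
      with cinterior_nonempty[OF wf(1)] cinterior_nonempty[OF wf(2)] disj show False by blast
    qed
    then have m1: "lor w w' = -1"
      using tangent_imp_lor_sq[OF wf tan] by (auto simp: power2_eq_1_iff w_def w'_def)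
    have "w + w' \<noteq> 0"
    proof
      assume "w + w' = 0"
      then have "w' = - w" by (simp add: eq_neg_iff_add_eq_0 add.commute)
      then have "cboundary C = cboundary C'" by (auto simp: bd lor_simps)
      with tan have "tangent C C" by (simp add: tangent_def)
      with not_tangent_self wf show False by blast
    qed
    moreover have "lor (w + w') (w + w') = 0"
      using m1 by (simp add: lor_simps ww lor_commute[of w' w])
    ultimately obtain r P where r: "r \<noteq> 0" and u: "w + w' = r *\<^sub>R lift P"
      by (metis null_eq_lift)
    have s: "lor w (lift Q) + lor w' (lift Q) = r * lor (lift P) (lift Q)" for Q
      using arg_cong[OF u, of "\<lambda>x. lor x (lift Q)"] by (simp add: lor_simps)
    have "r > 0"
    proof (rule ccontr)
      assume "\<not> r > 0"
      with r have r: "r < 0" by simp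
      \<comment> \<open>\<open>E\<close> consists of the points where \<open>w\<close> and
        \<open>w'\<close> have equal products. With \<open>r < 0\<close> the common value is
        positive away from \<open>P\<close>, so the interiors would meet.\<close>
      have "lor ((1/2) *\<^sub>R (w - w')) ((1/2) *\<^sub>R (w - w')) = 1"
        using m1 by (simp add: lor_simps ww lor_commute[of w' w])
      then obtain E where E: "wf_circle E" "cvec E = (1/2) *\<^sub>R (w - w')" by (rule cvec_surj)
      then obtain p where p: "Some p \<in> cboundary E" "P \<noteq> Some p"
        by (metis two_finite_boundary_points option.inject)
      then have "lor w (lift (Some p)) = lor w' (lift (Some p))"
        unfolding mem_cboundary_iff[OF E(1)] E(2) by (simp add: lor_simps del: lift.simps)
      moreover have "r * lor (lift P) (lift (Some p)) > 0"
        using r lift_lift(2)[OF p(2)] by (rule mult_neg_neg)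
      ultimately have "lor w (lift (Some p)) > 0" "lor w' (lift (Some p)) > 0"
        using s[of "Some p"] by linarith+
      then show False using disj int by blast
    qed
    then have "(w + w') $ 1 + (w + w') $ 2 > 0"
      unfolding u using lift_time_pos[of P] by (simp flip: distrib_left)
    with m1 show ?R by (simp add: w_def w'_def)
  next
    assume ?R
    then have m1: "lor w w' = -1" and pos: "(w + w') $ 1 + (w + w') $ 2 > 0"
      by (simp_all add: w_def w'_def)
    have "lor (w + w') (w + w') = 0"
      using m1 by (simp add: lor_simps ww lor_commute[of w' w])
    moreover have "w + w' \<noteq> 0" using pos by (metis zero_index add.right_neutral less_irrefl)
    ultimately obtain r P where r: "r \<noteq> 0" and u: "w + w' = r *\<^sub>R lift P"
      by (metis null_eq_lift)
    have "r > 0"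
      using pos lift_time_pos[of P] unfolding u by (simp add: zero_less_mult_iff flip: distrib_left)
    have s: "lor w (lift Q) + lor w' (lift Q) = r * lor (lift P) (lift Q)" for Q
      using arg_cong[OF u, of "\<lambda>x. lor x (lift Q)"] by (simp add: lor_simps)
    have "lor w (w + w') = 0" "lor w' (w + w') = 0"
      using m1 by (simp_all add: lor_simps ww lor_commute[of w' w])
    then have "P \<in> cboundary C" "P \<in> cboundary C'"
      using r unfolding u bd by (simp_all add: lor_simps)
    moreover have "Q = P" if "Q \<in> cboundary C" "Q \<in> cboundary C'" for Q
      using that s[of Q] r lift_lift(2)[of P Q] unfolding bd by auto
    ultimately have "tangent C C'" unfolding tangent_def by blast
    moreover have False if "p \<in> cinterior C" "p \<in> cinterior C'" for p
      using that s[of "Some p"] mult_nonneg_nonpos[OF _ lor_lift_nonpos, of r P "Some p"] \<open>r > 0\<close>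
      unfolding int by linarith
    ultimately show ?L by blast
  }
qed

section \<open>Moves\<close>

definition gram :: "(4 \<Rightarrow> real^4) \<Rightarrow> bool" where
  "gram W \<longleftrightarrow> (\<forall>i j. lor (W i) (W j) = (if i = j then 1 else -1))"

text \<open>The inverse of the Gram matrix \<open>2 I - J\<close> is \<open>I / 2 - J / 4\<close>, where \<open>J\<close> is the all-ones matrix.\<close>
lemma gram_expansion:
  assumes "gram W"
  shows "v = (\<Sum>k\<in>UNIV. (lor (W k) v / 2 - (\<Sum>j\<in>UNIV. lor (W j) v) / 4) *\<^sub>R W k)"
proof -
  define c where "c = (\<lambda>k v. lor (W k) v / 2 - (\<Sum>j\<in>UNIV. lor (W j) v) / 4)"
  define P where "P = (\<chi> k m. c k (axis m 1))"
  define T where "T = (\<chi> m k. W k $ m)"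
  have v: "v = (\<Sum>m\<in>UNIV. v $ m *\<^sub>R axis m 1)" for v :: "real^4"
    using basis_expansion[of v] by (simp add: scalar_mult_eq_scaleR)
  have Pv: "(P *v v) $ k = c k v" for k v
  proof -
    have lin: "lor (W j) v = (\<Sum>m\<in>UNIV. v $ m * lor (W j) (axis m 1))" for j
      by (subst v) (simp add: lor.sum_right lor.scaleR_right)
    show ?thesis
      unfolding P_def matrix_vector_mult_def c_def lin
      by (simp add: sum_4 algebra_simps add_divide_distrib)
  qed
  have "(P ** T) $ k $ i = mat 1 $ k $ i" for k i
  proof -
    have "(P ** T) $ k $ i = (P *v W i) $ k"
      by (simp add: matrix_matrix_mult_def matrix_vector_mult_def T_def)
    also have "\<dots> = c k (W i)" by (rule Pv)
    also have "\<dots> = mat 1 $ k $ i"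
      using assms exhaust_4[of i] unfolding gram_def c_def mat_def by (auto simp: sum_4)
    finally show ?thesis .
  qed
  then have "P ** T = mat 1" by (simp add: vec_eq_iff)
  \<comment> \<open>The columns of \<open>T\<close> are the \<open>W k\<close>; a left inverse of a
    square matrix is also a right inverse, so they span.\<close>
  then have "T ** P = mat 1" by (simp add: matrix_left_right_inverse)
  have Tx: "T *v x = (\<Sum>k\<in>UNIV. x $ k *\<^sub>R W k)" for x
    by (simp add: vec_eq_iff matrix_vector_mult_def T_def mult.commute)
  from \<open>T ** P = mat 1\<close> have "v = T *v (P *v v)" by (simp add: matrix_vector_mul_assoc)
  also have "\<dots> = (\<Sum>k\<in>UNIV. c k v *\<^sub>R W k)"
    by (simp add: Tx Pv)
  finally show ?thesis unfolding c_def .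
qed

text \<open>Row \<open>i\<close> of \<open>S_i W\<close>; for a Gram basis, the reflection of
  \<open>W i\<close> in the span of the other three vectors.\<close>

definition opp :: "4 \<Rightarrow> (4 \<Rightarrow> real^4) \<Rightarrow> real^4" where
  "opp i W = 2 *\<^sub>R (\<Sum>j\<in>UNIV - {i}. W j) - W i"

lemma sum_others: "(\<Sum>j\<in>UNIV - {i}. f j) = (\<Sum>j\<in>UNIV. f j) - f i" for f :: "4 \<Rightarrow> 'a::ab_group_add"
  by (simp add: sum_diff1)

lemma lor_opp: "lor v (opp i W) = 2 * (\<Sum>j\<in>UNIV. lor v (W j)) - 3 * lor v (W i)"
  by (simp add: opp_def sum_others lor_simps lor.sum_right)

lemma gram_sum: 
  assumes "gram W"
  shows "(\<Sum>j\<in>UNIV. lor (W k) (W j)) = -2"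
  using assms exhaust_4[of k] by (auto simp: gram_def sum_4)

lemma gram_opp:
  assumes "gram W"
  shows "gram (W(i := opp i W))" "lor (W i) (opp i W) = -7"
proof -
  \<comment> \<open>The rows of the Gram matrix sum to -2, so the values are \<open>-4 - 3\<close>
    and \<open>-4 + 3\<close>.\<close>
  have 1: "lor (W k) (opp i W) = (if k = i then -7 else -1)" for k
    unfolding lor_opp gram_sum[OF assms] using assms by (simp add: gram_def)
  then have 2: "lor (opp i W) (W k) = (if k = i then -7 else -1)" for k
    using lor_commute by metis
  have "lor (opp i W) (opp i W) = 1"
    unfolding lor_opp[of "opp i W"] 2 using exhaust_4[of i] by (auto simp: sum_4)
  with 1 2 show "gram (W(i := opp i W))" using assms by (simp add: gram_def)
  show "lor (W i) (opp i W) = -7" using 1 by simp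
qed

text \<open>By the expansion, \<open>u\<close> depends only on \<open>t = lor (W i) u\<close>, and
  \<open>lor u u = 1\<close> is a quadratic equation in \<open>t\<close> with roots 1 and -7,
  attained by \<open>W i\<close> and \<open>opp i W\<close>.\<close>

lemma gram_completion_unique:
  assumes W: "gram W" and u: "lor u u = 1" "\<And>j. j \<noteq> i \<Longrightarrow> lor (W j) u = -1"
  shows "u = W i \<or> u = opp i W"
proof -
  define t where "t = lor (W i) u"
  have p: "lor (W k) u = (if k = i then t else -1)" for k using u(2) by (simp add: t_def)
  have S: "(\<Sum>j\<in>UNIV. lor (W j) u) = t - 3" unfolding p using exhaust_4[of i] by (auto simp: sum_4)
  have e: "u = (\<Sum>k\<in>UNIV. (lor (W k) u / 2 - (t - 3) / 4) *\<^sub>R W k)"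
    using gram_expansion[OF W, of u] unfolding S .
  have "lor u u = (\<Sum>k\<in>UNIV. (lor (W k) u / 2 - (t - 3) / 4) * lor (W k) u)"
    by (subst e) (simp add: lor.sum_left lor_simps)
  also have "\<dots> = (t\<^sup>2 + 6 * t - 3) / 4"
    unfolding p using exhaust_4[of i] by (auto simp: sum_4 field_simps power2_eq_square)
  finally have "(t - 1) * (t + 7) = 0" using u(1) by (simp add: algebra_simps power2_eq_square)
  then consider "t = 1" | "t = -7" by auto
  then show ?thesis
  proof cases
    case 1
    then have "u = (\<Sum>k\<in>UNIV. if k = i then W k else 0)"
      by (subst e) (intro sum.cong refl, auto simp: p)
    then show ?thesis by simp
  next
    case 2
    have "u = (\<Sum>k\<in>UNIV. 2 *\<^sub>R W k - (if k = i then 3 *\<^sub>R W k else 0))"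
      by (subst e) (intro sum.cong refl, auto simp: p 2 scaleR_left_diff_distrib[symmetric])
    also have "\<dots> = opp i W"
      by (simp add: sum_subtractf scaleR_sum_right[symmetric] opp_def sum_others vec_eq_iff)
    finally show ?thesis ..
  qed
qed

text \<open>Lifted points never have a positive product, so a negative one puts both null vectors
  into the same half of the light cone.\<close>

lemma null_positive:
  fixes u v :: "real^4"
  assumes "lor u u = 0" "lor v v = 0" "lor u v < 0" "v$1 + v$2 > 0"
  shows "u$1 + u$2 > 0"
proof -
  have "u \<noteq> 0" "v \<noteq> 0" using assms(3) by (auto simp: lor.zero_left lor.zero_right)
  then obtain r P s Q where u: "r \<noteq> 0" "u = r *\<^sub>R lift P" and v: "s \<noteq> 0" "v = s *\<^sub>R lift Q"
    using assms(1,2) by (metis null_eq_lift)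
  have "s > 0"
    using assms(4) lift_time_pos[of Q] unfolding v by (simp add: zero_less_mult_iff flip: distrib_left)
  moreover have "r * (s * lor (lift P) (lift Q)) < 0"
    using assms(3) by (simp add: u v lor_simps mult_ac)
  ultimately have "r > 0"
    using lor_lift_nonpos[of P Q] by (auto simp: mult_less_0_iff zero_less_mult_iff)
  then show ?thesis using lift_time_pos[of P] unfolding u by (simp flip: distrib_left)
qed

section \<open>Descartes configurations and the replaced circle\<close>

lemma descartes_iff:
  "descartes D \<longleftrightarrow> (\<forall>i. wf_circle (D i)) \<and> gram (\<lambda>i. cvec (D i)) \<and>
     (\<forall>i j. i \<noteq> j \<longrightarrow> (cvec (D i) + cvec (D j)) $ 1 + (cvec (D i) + cvec (D j)) $ 2 > 0)"
proof (cases "\<forall>i. wf_circle (D i)")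
  case True
  then have "descartes D \<longleftrightarrow> (\<forall>i j. i \<noteq> j \<longrightarrow> lor (cvec (D i)) (cvec (D j)) = -1 \<and>
     (cvec (D i) + cvec (D j)) $ 1 + (cvec (D i) + cvec (D j)) $ 2 > 0)"
    unfolding descartes_def by (simp only: tangent_disjoint_iff simp_thms)
  also have "\<dots> \<longleftrightarrow> gram (\<lambda>i. cvec (D i)) \<and>
     (\<forall>i j. i \<noteq> j \<longrightarrow> (cvec (D i) + cvec (D j)) $ 1 + (cvec (D i) + cvec (D j)) $ 2 > 0)"
    unfolding gram_def using True lor_cvec_self by (metis (lifting))
  finally show ?thesis using True by simp
next
  case False
  then show ?thesis unfolding descartes_def by blast
qed

lemma ex_two_others: "\<exists>k l. k \<noteq> i \<and> l \<noteq> i \<and> k \<noteq> l \<and> j \<noteq> k \<and> (j \<noteq> i \<longrightarrow> j \<noteq> l)" for i j :: 4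
proof -
  have "card (UNIV - {i, j}) \<ge> 2"
    by (subst card_Diff_subset) (auto simp: card_insert_if)
  then obtain T where "T \<subseteq> UNIV - {i, j}" "card T = 2" by (rule obtain_subset_with_card_n)
  then obtain k l where "k \<in> UNIV - {i, j}" "l \<in> UNIV - {i, j}" "k \<noteq> l"
    by (auto simp: card_2_iff)
  then show ?thesis by blast
qed

lemma descartes_opp:
  assumes D: "descartes D" and c: "wf_circle c" "cvec c = opp i (\<lambda>j. cvec (D j))"
  shows "descartes (D(i := c))"
proof -
  define W where "W = (\<lambda>j. cvec (D j))"
  have wf: "wf_circle (D j)" and W: "gram W"
    and pos: "j \<noteq> k \<Longrightarrow> (W j + W k) $ 1 + (W j + W k) $ 2 > 0" for j k
    using D unfolding descartes_iff W_def by blast+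
  have g: "gram (W(i := opp i W))" using gram_opp[OF W] by simp
  have ij: "(opp i W + W j) $ 1 + (opp i W + W j) $ 2 > 0" if "j \<noteq> i" for j
  proof -
    obtain k l where kl: "k \<noteq> i" "l \<noteq> i" "k \<noteq> l" "j \<noteq> k" "j \<noteq> l"
      using ex_two_others[of i j] that by blast
    have a: "lor (opp i W) (opp i W) = 1" "m \<noteq> i \<Longrightarrow> lor (opp i W) (W m) = -1" 
       "m \<noteq> i \<Longrightarrow> lor (W m) (opp i W) = -1" for m
      using g unfolding gram_def by (metis fun_upd_same fun_upd_other)+
    have b: "lor (W m) (W n) = (if m = n then 1 else -1)" for m n using W by (simp add: gram_def)
    \<comment> \<open>Sums over tangent pairs are null; crossing the pairs gives four products -1,
      so positivity passes from the old pair \<open>k\<close>, \<open>l\<close> to the new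
      one.\<close>
    have n: "lor (opp i W + W j) (opp i W + W j) = 0" "lor (W k + W l) (W k + W l) = 0"
      and m: "lor (opp i W + W j) (W k + W l) = -4"
      using kl that by (simp_all add: lor_simps a b)
    show ?thesis by (rule null_positive[OF n _ pos[OF kl(3)]]) (simp add: m)
  qed
  have wf': "wf_circle ((D(i := c)) j)" for j using wf c(1) by simp
  have e: "cvec ((D(i := c)) j) = (W(i := opp i W)) j" for j using c by (simp add: W_def)
  have "(((W(i := opp i W)) j + (W(i := opp i W)) k) $ 1 + ((W(i := opp i W)) j + (W(i := opp i W)) k) $ 2) > 0"
    if "j \<noteq> k" for j k
    using ij[of j] ij[of k] pos[OF that] that
    by (cases "j = i"; cases "k = i") (simp_all add: add.commute)
  then show ?thesis unfolding descartes_iff[of "D(i := c)"] e using wf' g by (simp del: fun_upd_apply)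
qed

lemma apollo_move:
  assumes "descartes D"
  shows "descartes (apollo_move i D)" "\<And>j. j \<noteq> i \<Longrightarrow> apollo_move i D j = D j"
    "cvec (apollo_move i D i) = opp i (\<lambda>j. cvec (D j))" "apollo_move i (apollo_move i D) = D"
proof -
  have *: "\<exists>c. c \<noteq> D i \<and> descartes (D(i := c)) \<and> cvec c = opp i (\<lambda>j. cvec (D j)) \<and>
    (\<forall>c'. c' \<noteq> D i \<and> descartes (D(i := c')) \<longrightarrow> c' = c)" if D: "descartes D" for D
  proof -
    define W where "W = (\<lambda>j. cvec (D j))"
    have W: "gram W" using D by (simp add: descartes_iff W_def)
    note g = gram_opp[OF W, of i]
    have "lor (opp i W) (opp i W) = 1" using g(1) unfolding gram_def by (metis fun_upd_same)
    then obtain c where c: "wf_circle c" "cvec c = opp i W" by (rule cvec_surj)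
    have "c \<noteq> D i"
    proof
      assume "c = D i"
      then have "opp i W = W i" using c(2) by (simp add: W_def)
      with g(2) W show False by (simp add: gram_def)
    qed
    moreover have "descartes (D(i := c))" using descartes_opp[OF D c(1)] c(2) by (simp add: W_def)
    moreover have "c' = c" if c': "c' \<noteq> D i" "descartes (D(i := c'))" for c'
    proof -
      have "lor (W j) (cvec c') = -1" if "j \<noteq> i" for j
        using c'(2) that unfolding descartes_iff gram_def W_def by (metis fun_upd_same fun_upd_other)
      moreover have wf: "wf_circle c'" "wf_circle (D i)"
        using c'(2) D unfolding descartes_def by (metis fun_upd_same)+
      ultimately have "cvec c' = W i \<or> cvec c' = opp i W"
        using gram_completion_unique[OF W, of "cvec c'" i] lor_cvec_self by blast
      then show ?thesis using cvec_inj wf c c'(1) unfolding W_def by metis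
    qed
    ultimately show ?thesis using c(2) unfolding W_def by blast
  qed
  have the: "(THE c. c \<noteq> D i \<and> descartes (D(i := c))) = c"
    if "c \<noteq> D i" "descartes (D(i := c))" "descartes D" for c D
    using *[OF that(3)] that by (intro the_equality) blast+
  obtain c where c: "c \<noteq> D i" "descartes (D(i := c))" "cvec c = opp i (\<lambda>j. cvec (D j))"
    using *[OF assms] by blast
  then have m: "apollo_move i D = D(i := c)"
    using the[OF _ _ assms, of c] by (simp add: apollo_move_def)
  with c show "descartes (apollo_move i D)" "\<And>j. j \<noteq> i \<Longrightarrow> apollo_move i D j = D j"
    "cvec (apollo_move i D i) = opp i (\<lambda>j. cvec (D j))" by simp_all
  show "apollo_move i (apollo_move i D) = D"
    unfolding m apollo_move_def[of i "D(i := c)"]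
    using the[of "D i" "D(i := c)"] c(1,2) assms by auto
qed

section \<open>Orbits and reduced words\<close>

lemma orbit_descartes: "D' \<in> apollo_orbit D \<Longrightarrow> descartes D \<Longrightarrow> descartes D'"
  by (induction rule: apollo_orbit.induct) (auto intro: apollo_move)

lemma orbit_trans: "D'' \<in> apollo_orbit D' \<Longrightarrow> D' \<in> apollo_orbit D \<Longrightarrow> D'' \<in> apollo_orbit D"
  by (induction rule: apollo_orbit.induct) (auto intro: apollo_orbit.step)

lemma orbit_sym: "D' \<in> apollo_orbit D \<Longrightarrow> descartes D \<Longrightarrow> D \<in> apollo_orbit D'"
proof (induction rule: apollo_orbit.induct)
  case (step D' i)
  have "apollo_move i (apollo_move i D') \<in> apollo_orbit (apollo_move i D')"
    by (intro apollo_orbit.intros)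
  then have "D' \<in> apollo_orbit (apollo_move i D')"
    using apollo_move(4) orbit_descartes[OF step.hyps step.prems] by simp
  with step show ?case by (blast intro: orbit_trans)
qed (rule apollo_orbit.base)

text \<open>\<open>l\<close> is the last move, which may not be repeated. For the empty word it is
  arbitrary, so every first move is allowed.\<close>

inductive reduced :: "(4 \<Rightarrow> ocircle) \<Rightarrow> 4 \<Rightarrow> (4 \<Rightarrow> ocircle) \<Rightarrow> bool" for D where
  base: "reduced D l D"
| step: "reduced D l V \<Longrightarrow> i \<noteq> l \<Longrightarrow> reduced D i (apollo_move i V)"

lemma reduced_orbit: "reduced D l V \<Longrightarrow> V \<in> apollo_orbit D"
  by (induction rule: reduced.induct) (auto intro: apollo_orbit.intros)

lemma orbit_reduced:
  assumes "descartes D" "V \<in> apollo_orbit D"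
  shows "\<exists>l. reduced D l V"
  using assms(2)
proof (induction rule: apollo_orbit.induct)
  case base
  show ?case using reduced.base by blast
next
  case (step V i)
  then obtain l where l: "reduced D l V" by blast
  show ?case
  proof (cases "i = l")
    case False
    with l show ?thesis by (blast intro: reduced.step)
  next
    case True
    from l show ?thesis
    proof cases
      case base
      obtain l' where "l' \<noteq> i" using ex_two_others[of i] by blast
      then show ?thesis using base reduced.base reduced.step by metis
    next
      case (step l' V')
      then have "descartes V'" using reduced_orbit orbit_descartes assms(1) by blast
      then have "apollo_move i V = V'" using step True by (simp add: apollo_move)
      then show ?thesis using step by blast
    qed
  qed
qed

text \<open>\<open>side s V i\<close> is the product of \<open>s\<close> with a normal vector of the circle through the
  tangency points of the three circles \<open>V j\<close>, \<open>j \<noteq> i\<close>; the move \<open>i\<close> is the inversion in this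
  circle and changes the product of \<open>s\<close> with the \<open>i\<close>-th circle by \<open>2 * side s V i\<close>.\<close>
definition side :: "ocircle \<Rightarrow> (4 \<Rightarrow> ocircle) \<Rightarrow> 4 \<Rightarrow> real" where
  "side s V i = (\<Sum>j\<in>UNIV. lor (cvec s) (cvec (V j))) - 2 * lor (cvec s) (cvec (V i))"

lemma lor_apollo_move:
  assumes "descartes V"
  shows "lor (cvec s) (cvec (apollo_move i V j)) =
    lor (cvec s) (cvec (V j)) + (if j = i then 2 * side s V i else 0)"
  using apollo_move(2,3)[OF assms] by (simp add: lor_opp side_def)

lemma side_apollo_move:
  assumes "descartes V"
  shows "side s (apollo_move i V) j = (if j = i then - side s V i else side s V j + 2 * side s V i)"
  unfolding side_def[of s "apollo_move i V"] lor_apollo_move[OF assms]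
  by (simp add: sum.distrib) (simp add: side_def)

text \<open>Only the wall \<open>l\<close> just crossed may have a positive side. The bound on
  \<open>side s V j + side s V l\<close> makes the induction work: after the next move
  \<open>i\<close>, the side at \<open>l\<close> is
  \<open>side s V l + 2 * side s V i\<close>.\<close>

lemma reduced_invariant:
  assumes "descartes D" "s \<in> range D" "reduced D l V"
  shows "(\<forall>j. j \<noteq> l \<longrightarrow> side s V j \<le> 0 \<and> side s V j + side s V l \<le> 0) \<and>
    (\<forall>j. V j = s \<or> lor (cvec s) (cvec (V j)) \<le> -1)"
  using assms(3)
proof (induction rule: reduced.induct)
  case (base l)
  obtain i where i: "s = D i" using assms(2) by blast
  have g: "gram (\<lambda>i. cvec (D i))" using assms(1) by (simp add: descartes_iff)
  then have "side s D j \<le> 0" for j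
    using gram_sum[OF g, of i] unfolding side_def i by (simp add: gram_def)
  then show ?case
    using g by (auto simp: gram_def i intro: add_nonpos_nonpos)
next
  case (step l V i)
  have V: "descartes V" using assms(1) step.hyps reduced_orbit orbit_descartes by blast
  have g: "gram (\<lambda>i. cvec (V i))" using V by (simp add: descartes_iff)
  have le: "side s V i \<le> 0" "side s V i + side s V l \<le> 0" using step by auto
  have "side s (apollo_move i V) j \<le> 0 \<and> side s (apollo_move i V) j + side s (apollo_move i V) i \<le> 0"
    if "j \<noteq> i" for j
  proof (cases "j = l")
    case True
    then show ?thesis using le that by (simp add: side_apollo_move[OF V])
  next
    case False
    then have "side s V j \<le> 0" using step.IH by blast
    then show ?thesis using le that by (simp add: side_apollo_move[OF V])
  qed
  moreover have "apollo_move i V j = s \<or> lor (cvec s) (cvec (apollo_move i V j)) \<le> -1" for j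
  proof (cases "V j = s \<and> j = i")
    case True
    \<comment> \<open>The move removes \<open>s\<close> itself: the replacement has product
      \<open>1 + 2 * (-4) = -7\<close> with \<open>s\<close>.\<close>
    then have "side s V i = -4"
      using gram_sum[OF g, of i] g unfolding side_def by (auto simp: gram_def)
    then show ?thesis using True g by (auto simp: lor_apollo_move[OF V] gram_def)
  next
    case False
    then show ?thesis
      using step.IH le(1) apollo_move(2)[OF V, of j i] unfolding lor_apollo_move[OF V] by (smt (verit))
  qed
  ultimately show ?case by blast
qed

text \<open>A circle tangent to all of \<open>S\<close> that is created by the last move of a reduced word must already
  be created from a configuration containing \<open>S\<close>: the products of an \<open>s \<in> S\<close> with the three circles
  that stay have sum \<open>-1\<close>, so they cannot all be \<open>\<le> -1\<close>.\<close>
lemma orbit_extend: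
  assumes D: "descartes D" and S: "S \<subseteq> range D" and V: "V \<in> apollo_orbit D"
    and tan: "\<And>s. s \<in> S \<Longrightarrow> lor (cvec s) (cvec (V k)) = -1"
  shows "\<exists>V' \<in> apollo_orbit D. insert (V k) S \<subseteq> range V'"
proof -
  obtain l where "reduced D l V" using orbit_reduced[OF D V] by blast
  then show ?thesis using tan
  proof (induction rule: reduced.induct)
    case base
    then show ?case using S by (intro bexI[of _ D]) (auto intro: apollo_orbit.base)
  next
    case (step l V i)
    have V: "descartes V" using D step.hyps reduced_orbit orbit_descartes by blast
    show ?case
    proof (cases "k = i")
      case False
      then have "apollo_move i V k = V k" using apollo_move(2)[OF V] by blast
      then show ?thesis using step by metis
    next
      case True
      have "s \<in> range (apollo_move i V)" if s: "s \<in> S" for s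
      proof (rule ccontr)
        assume n: "s \<notin> range (apollo_move i V)"
        let ?q = "\<lambda>j. lor (cvec s) (cvec (V j))"
        have inv: "V j = s \<or> ?q j \<le> -1" "side s V i \<le> 0" for j
          using reduced_invariant[OF D _ step.hyps(1)] s S step.hyps(2) by blast+
        have m1: "?q i + 2 * side s V i = -1"
          using step.prems[OF s] unfolding True lor_apollo_move[OF V] by simp
        have o: "?q j \<le> -1" if "j \<noteq> i" for j
          using inv(1)[of j] n apollo_move(2)[OF V that] by (metis rangeI)
        \<comment> \<open>This sum is \<open>side s V i + ?q i\<close>, which \<open>m1\<close>
          turns into \<open>- 1 - side s V i\<close>, at least -1.\<close>
        have "(\<Sum>j\<in>UNIV. ?q j) - ?q i \<le> -3"
          unfolding sum_4 using exhaust_4[of i] o[of 1] o[of 2] o[of 3] o[of 4] by auto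
        then have "side s V i + ?q i \<le> -3" unfolding side_def by linarith
        with inv(2) m1 show False by linarith
      qed
      then show ?thesis
        using True reduced_orbit[OF reduced.step[OF step.hyps(1,2)]] by blast
    qed
  qed
qed

section \<open>Integrality\<close>

lemma Ints_if_Rats_sq:
  fixes x :: real
  assumes "x \<in> \<rat>" "x\<^sup>2 \<in> \<int>"
  shows "x \<in> \<int>"
proof -
  obtain m n where n: "n \<noteq> 0" and x: "\<bar>x\<bar> = real m / real n" and cop: "coprime m n"
    using Rats_abs_nat_div_natE[OF assms(1)] by metis
  obtain k where k: "x\<^sup>2 = of_int k" using assms(2) by (auto elim: Ints_cases)
  have "(real m / real n)\<^sup>2 = of_int k" using k x by (metis power2_abs)
  then have "(real m)\<^sup>2 = of_int k * (real n)\<^sup>2"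
    using n by (simp add: power_divide field_simps)
  then have "(of_int ((int m)\<^sup>2) :: real) = of_int (k * (int n)\<^sup>2)" by simp
  then have "(int m)\<^sup>2 = k * (int n)\<^sup>2" by (simp only: of_int_eq_iff)
  then have "int n dvd (int m)\<^sup>2" by (simp add: power2_eq_square)
  then have "n dvd m\<^sup>2" by (metis of_nat_dvd_iff of_nat_power)
  moreover have "coprime (m\<^sup>2) n" using cop by simp
  ultimately have "n = 1" by (metis coprime_common_divisor_nat dvd_refl)
  then have "\<bar>x\<bar> \<in> \<int>" using x by simp
  then show ?thesis by (metis abs_if minus_in_Ints_iff)
qed

text \<open>The six assumptions say that the Gram matrix of the columns \<open>b\<close>, \<open>x\<close>, \<open>y\<close> with respect to \<open>J - I\<close>
  is \<open>2 (u u\<^sup>T - diag(0, 1, 1))\<close> with \<open>u = (\<beta>, \<xi>, \<eta>)\<close>; the claim compares determinants.\<close>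
lemma sq_det_eq:
  fixes b1 b2 b3 x1 x2 x3 y1 y2 y3 \<beta> \<xi> \<eta> :: real
  assumes "b1*b2 + b1*b3 + b2*b3 = \<beta>\<^sup>2"
    "x1*x2 + x1*x3 + x2*x3 = \<xi>\<^sup>2 - 1" "y1*y2 + y1*y3 + y2*y3 = \<eta>\<^sup>2 - 1"
    "b1*x2 + b2*x1 + b1*x3 + b3*x1 + b2*x3 + b3*x2 = 2*\<beta>*\<xi>"
    "b1*y2 + b2*y1 + b1*y3 + b3*y1 + b2*y3 + b3*y2 = 2*\<beta>*\<eta>"
    "x1*y2 + x2*y1 + x1*y3 + x3*y1 + x2*y3 + x3*y2 = 2*\<xi>*\<eta>"
  shows "(2*\<beta>)\<^sup>2 = (b1*(x2*y3 - x3*y2) - b2*(x1*y3 - x3*y1) + b3*(x1*y2 - x2*y1))\<^sup>2"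
proof -
  define B X Y P Q R where d: "B = 2*(b1*b2 + b1*b3 + b2*b3)" "X = 2*(x1*x2 + x1*x3 + x2*x3)"
    "Y = 2*(y1*y2 + y1*y3 + y2*y3)" "P = b1*x2 + b2*x1 + b1*x3 + b3*x1 + b2*x3 + b3*x2"
    "Q = b1*y2 + b2*y1 + b1*y3 + b3*y1 + b2*y3 + b3*y2"
    "R = x1*y2 + x2*y1 + x1*y3 + x3*y1 + x2*y3 + x3*y2"
  \<comment> \<open>The right-hand side is the cofactor expansion of the Gram determinant; the
    factor 2 is the determinant of \<open>J - I\<close>.\<close>
  have "2 * (b1*(x2*y3 - x3*y2) - b2*(x1*y3 - x3*y1) + b3*(x1*y2 - x2*y1))\<^sup>2 =
      B*(X*Y - R\<^sup>2) - P*(P*Y - R*Q) + Q*(P*R - X*Q)"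
    unfolding d by algebra
  also have "\<dots> = 8 * \<beta>\<^sup>2"
  proof -
    have *: "B = 2*\<beta>\<^sup>2" "X = 2*\<xi>\<^sup>2 - 2" "Y = 2*\<eta>\<^sup>2 - 2" "P = 2*\<beta>*\<xi>" "Q = 2*\<beta>*\<eta>" "R = 2*\<xi>*\<eta>"
      unfolding d using assms by simp_all
    show ?thesis unfolding * by (simp add: algebra_simps power2_eq_square)
  qed
  finally show ?thesis by (simp add: power_mult_distrib)
qed

lemma integral_half_difference:
  fixes b1 b2 b3 x1 x2 x3 y1 y2 y3 \<beta> \<xi> \<eta> :: real
  assumes ints: "b1 \<in> \<int>" "b2 \<in> \<int>" "b3 \<in> \<int>" "x1 \<in> \<int>" "x2 \<in> \<int>" "x3 \<in> \<int>" "y1 \<in> \<int>" "y2 \<in> \<int>" "y3 \<in> \<int>"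
    and rel: "b1*b2 + b1*b3 + b2*b3 = \<beta>\<^sup>2"
    "x1*x2 + x1*x3 + x2*x3 = \<xi>\<^sup>2 - 1" "y1*y2 + y1*y3 + y2*y3 = \<eta>\<^sup>2 - 1"
    "b1*x2 + b2*x1 + b1*x3 + b3*x1 + b2*x3 + b3*x2 = 2*\<beta>*\<xi>"
    "b1*y2 + b2*y1 + b1*y3 + b3*y1 + b2*y3 + b3*y2 = 2*\<beta>*\<eta>"
    "x1*y2 + x2*y1 + x1*y3 + x3*y1 + x2*y3 + x3*y2 = 2*\<xi>*\<eta>"
    and line: "\<beta> = 0 \<Longrightarrow> \<xi>\<^sup>2 + \<eta>\<^sup>2 = 1"
  shows "\<beta> \<in> \<int>" "\<xi> \<in> \<int>" "\<eta> \<in> \<int>"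
proof -
  have sq: "\<beta>\<^sup>2 \<in> \<int>" "\<xi>\<^sup>2 \<in> \<int>" "\<eta>\<^sup>2 \<in> \<int>"
  proof -
    have "\<xi>\<^sup>2 = x1*x2 + x1*x3 + x2*x3 + 1" "\<eta>\<^sup>2 = y1*y2 + y1*y3 + y2*y3 + 1"
      using rel by simp_all
    then show "\<beta>\<^sup>2 \<in> \<int>" "\<xi>\<^sup>2 \<in> \<int>" "\<eta>\<^sup>2 \<in> \<int>" using ints by (simp_all flip: rel(1))
  qed
  define d where "d = b1*(x2*y3 - x3*y2) - b2*(x1*y3 - x3*y1) + b3*(x1*y2 - x2*y1)"
  have "d \<in> \<int>" using ints by (simp add: d_def)
  moreover have "2 * \<beta> = d \<or> 2 * \<beta> = - d"
    using sq_det_eq[OF rel] unfolding d_def[symmetric] power2_eq_iff .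
  ultimately have 2: "2 * \<beta> \<in> \<int>" by auto
  have cross: "2*\<beta>*\<xi> \<in> \<int>" "2*\<beta>*\<eta> \<in> \<int>" using ints by (simp_all flip: rel)
  have rat: "r \<in> \<rat>" if "c * r \<in> \<int>" "c \<in> \<int>" "c \<noteq> 0" for c r :: real
  proof -
    have "r = (c * r) / c" using that by simp
    then show ?thesis using that by (metis Rats_divide Ints_subset_Rats subsetD)
  qed
  from 2 have "\<beta> \<in> \<rat>" using rat[of 2 \<beta>] by simp
  then show "\<beta> \<in> \<int>" using sq(1) by (rule Ints_if_Rats_sq)
  have "\<xi> \<in> \<rat> \<and> \<eta> \<in> \<rat>"
  proof (cases "\<beta> = 0")
    case False
    then show ?thesis using rat[OF _ 2] cross by simp
  next
    case True
    obtain m where m: "\<xi>\<^sup>2 = of_int m" using sq(2) by (auto elim: Ints_cases)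
    have "0 \<le> \<xi>\<^sup>2" "\<xi>\<^sup>2 \<le> 1"
      using line[OF True] zero_le_power2[of \<xi>] zero_le_power2[of \<eta>] by linarith+
    then have "m = 0 \<or> m = 1" unfolding m by auto
    then have "\<xi>\<^sup>2 = 0 \<and> \<eta>\<^sup>2 = 1 \<or> \<xi>\<^sup>2 = 1 \<and> \<eta>\<^sup>2 = 0" using m line[OF True] by auto
    then show ?thesis by (auto simp: power2_eq_1_iff)
  qed
  then show "\<xi> \<in> \<int>" "\<eta> \<in> \<int>" using Ints_if_Rats_sq sq by blast+
qed

text \<open>With \<open>W\<close> read as a matrix with rows \<open>W k\<close>, Gram matrix \<open>G\<close> and \<open>H\<close> the matrix of \<open>lor\<close>,
  these are entries of \<open>W\<^sup>T G\<^sup>-\<^sup>1 W = H\<^sup>-\<^sup>1\<close>, the Descartes theorem with centers.\<close>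
lemma gram_columns:
  assumes "gram W"
  shows "2 * (\<Sum>k\<in>UNIV. W k $ 2 * W k $ m) - (\<Sum>k\<in>UNIV. W k $ 2) * (\<Sum>k\<in>UNIV. W k $ m) =
      (if m = 1 then -8 else 0)"
    "2 * (\<Sum>k\<in>UNIV. W k $ 3 * W k $ m) - (\<Sum>k\<in>UNIV. W k $ 3) * (\<Sum>k\<in>UNIV. W k $ m) =
      (if m = 3 then 4 else 0)"
    "2 * (\<Sum>k\<in>UNIV. W k $ 4 * W k $ m) - (\<Sum>k\<in>UNIV. W k $ 4) * (\<Sum>k\<in>UNIV. W k $ m) =
      (if m = 4 then 4 else 0)"
proof -
  have e: "2 * (\<Sum>k\<in>UNIV. lor (W k) v * W k $ m) -
    (\<Sum>k\<in>UNIV. lor (W k) v) * (\<Sum>k\<in>UNIV. W k $ m) = 4 * v $ m" for v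
    using arg_cong[OF gram_expansion[OF assms, of v], of "\<lambda>x. x $ m"]
    by (simp add: sum_4 algebra_simps add_divide_distrib diff_divide_distrib)
  \<comment> \<open>Products with these vectors read off the coordinates; four times their nonzero
    entries gives the -8 and the 4.\<close>
  have l: "lor u (vec4 (-2) 0 0 0) = u $ 2" "lor u (vec4 0 0 1 0) = u $ 3"
    "lor u (vec4 0 0 0 1) = u $ 4" for u by (simp_all add: lor_def)
  note m = exhaust_4[of m]
  from e[of "vec4 (-2) 0 0 0"] m show "2 * (\<Sum>k\<in>UNIV. W k $ 2 * W k $ m) -
    (\<Sum>k\<in>UNIV. W k $ 2) * (\<Sum>k\<in>UNIV. W k $ m) = (if m = 1 then -8 else 0)" unfolding l by auto
  from e[of "vec4 0 0 1 0"] m show "2 * (\<Sum>k\<in>UNIV. W k $ 3 * W k $ m) -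
    (\<Sum>k\<in>UNIV. W k $ 3) * (\<Sum>k\<in>UNIV. W k $ m) = (if m = 3 then 4 else 0)" unfolding l by auto
  from e[of "vec4 0 0 0 1"] m show "2 * (\<Sum>k\<in>UNIV. W k $ 4 * W k $ m) -
    (\<Sum>k\<in>UNIV. W k $ 4) * (\<Sum>k\<in>UNIV. W k $ m) = (if m = 4 then 4 else 0)" unfolding l by auto
qed

lemma integral_ccc_iff:
  "integral_ccc C \<longleftrightarrow> cvec C $ 2 \<in> \<int> \<and> cvec C $ 3 \<in> \<int> \<and> cvec C $ 4 \<in> \<int>"
  by (cases C) (simp_all add: integral_ccc_def)

lemma fourth_integral:
  assumes W: "gram W" and UN: "distinct [i, j, k, l]"
    and int: "\<And>m n. m \<in> {i, j, k} \<Longrightarrow> n \<in> {2, 3, 4} \<Longrightarrow> W m $ n \<in> \<int>"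
    and n: "n \<in> {2, 3, 4}"
  shows "W l $ n \<in> \<int>"
proof -
  have "card {i, j, k, l} = card (UNIV :: 4 set)" using UN by simp
  then have U: "UNIV = {i, j, k, l}" by (metis card_subset_eq finite subset_UNIV)
  have sum: "sum f UNIV = f i + f j + f k + f l" for f :: "4 \<Rightarrow> real"
    unfolding U using UN by (simp add: ac_simps)
  \<comment> \<open>A unit vector orthogonal to \<open>W i\<close>, \<open>W j\<close> and
    \<open>W k\<close>: the circle through their tangency points, with curvature
    \<open>u $ 2\<close>.\<close>
  define u where "u = (1/2) *\<^sub>R (W l - W i - W j - W k)"
  have ul: "W l $ n = 2 * u $ n + W i $ n + W j $ n + W k $ n" for n by (simp add: u_def field_simps)
  have "lor u u = 1"
    using W UN by (auto simp: u_def lor_simps gram_def)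
  then have line: "u $ 2 = 0 \<Longrightarrow> (u $ 3)\<^sup>2 + (u $ 4)\<^sup>2 = 1"
    by (simp add: lor_def power2_eq_square)
  \<comment> \<open>After substituting \<open>ul\<close>, the terms mixing \<open>u\<close> with the
    other vectors cancel.\<close>
  have e: "W i $ m * W j $ n + W j $ m * W i $ n + W i $ m * W k $ n + W k $ m * W i $ n +
      W j $ m * W k $ n + W k $ m * W j $ n = 2 * u $ m * u $ n - a / 2"
    if "2 * (\<Sum>k\<in>UNIV. W k $ m * W k $ n) - (\<Sum>k\<in>UNIV. W k $ m) * (\<Sum>k\<in>UNIV. W k $ n) = a" for m n a
    using that unfolding sum ul[of m] ul[of n] by (simp add: algebra_simps)
  note c = gram_columns[OF W, THEN e]
  have "u $ 2 \<in> \<int> \<and> u $ 3 \<in> \<int> \<and> u $ 4 \<in> \<int>"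
  proof (intro conjI)
    note * = integral_half_difference[of "W i $ 2" "W j $ 2" "W k $ 2"
      "W i $ 3" "W j $ 3" "W k $ 3" "W i $ 4" "W j $ 4" "W k $ 4" "u $ 2" "u $ 3" "u $ 4",
      OF int int int int int int int int int _ _ _ _ _ _ line]
    have "W i $ 2 * W j $ 2 + W i $ 2 * W k $ 2 + W j $ 2 * W k $ 2 = (u $ 2)\<^sup>2"
      "W i $ 3 * W j $ 3 + W i $ 3 * W k $ 3 + W j $ 3 * W k $ 3 = (u $ 3)\<^sup>2 - 1"
      "W i $ 4 * W j $ 4 + W i $ 4 * W k $ 4 + W j $ 4 * W k $ 4 = (u $ 4)\<^sup>2 - 1"
      using c(1)[of 2] c(2)[of 3] c(3)[of 4] by (simp_all add: power2_eq_square mult.commute)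
    with c(1)[of 3] c(1)[of 4] c(2)[of 4]
    show "u $ 2 \<in> \<int>" "u $ 3 \<in> \<int>" "u $ 4 \<in> \<int>" by (intro *; simp)+
  qed
  then show ?thesis using int n unfolding ul[of n] by auto
qed

theorem theorem9p2:
  fixes D :: "4 \<Rightarrow> ocircle"
  assumes "descartes D"
  shows "strongly_integral D \<longleftrightarrow>
    (\<exists>C1 C2 C3. C1 \<in> apollo_packing D \<and> C2 \<in> apollo_packing D \<and> C3 \<in> apollo_packing D \<and>
       tangent C1 C2 \<and> tangent C1 C3 \<and> tangent C2 C3 \<and>
       integral_ccc C1 \<and> integral_ccc C2 \<and> integral_ccc C3)"
proof
  assume "strongly_integral D"
  then obtain D' where D': "D' \<in> apollo_orbit D" "\<And>i. integral_ccc (D' i)"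
    unfolding strongly_integral_def by blast
  then have "tangent (D' i) (D' j)" if "i \<noteq> j" for i j
    using orbit_descartes[OF D'(1) assms] that unfolding descartes_def by blast
  then have "tangent (D' 1) (D' 2)" "tangent (D' 1) (D' 3)" "tangent (D' 2) (D' 3)" by simp_all
  moreover have "D' i \<in> apollo_packing D" for i using D' unfolding apollo_packing_def by blast
  ultimately show "\<exists>C1 C2 C3. C1 \<in> apollo_packing D \<and> C2 \<in> apollo_packing D \<and> C3 \<in> apollo_packing D \<and>
       tangent C1 C2 \<and> tangent C1 C3 \<and> tangent C2 C3 \<and>
       integral_ccc C1 \<and> integral_ccc C2 \<and> integral_ccc C3" using D'(2) by blast
next
  have des: "descartes E" if "E \<in> apollo_orbit D" for E
    using orbit_descartes[OF that assms] .
  have orb: "F \<in> apollo_orbit E" if "E \<in> apollo_orbit D" "F \<in> apollo_orbit D" for E F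
    using that orbit_trans orbit_sym[OF _ assms] by blast
  \<comment> \<open>Tangency leaves the products 1 and -1; restarting the orbit at a configuration
    containing \<open>C\<close> bounds the product by -1.\<close>
  have m1: "lor (cvec C) (cvec C') = -1"
    if "C \<in> apollo_packing D" "C' \<in> apollo_packing D" "tangent C C'" for C C'
  proof -
    obtain E F i j where E: "E \<in> apollo_orbit D" "C = E i" and F: "F \<in> apollo_orbit D" "C' = F j"
      using \<open>C \<in> _\<close> \<open>C' \<in> _\<close> unfolding apollo_packing_def by blast
    have wf: "wf_circle C" "wf_circle C'" using des E F unfolding descartes_def by blast+
    obtain l where "reduced E l F" using orbit_reduced[OF des orb] E F by blast
    then have "C' = C \<or> lor (cvec C) (cvec C') \<le> -1"
      using reduced_invariant[OF des[OF E(1)], of C l F] E F by blast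
    then have "lor (cvec C) (cvec C') \<le> -1" using not_tangent_self wf that by blast
    then show ?thesis using tangent_imp_lor_sq[OF wf that(3)] by (auto simp: power2_eq_1_iff)
  qed
  assume "\<exists>C1 C2 C3. C1 \<in> apollo_packing D \<and> C2 \<in> apollo_packing D \<and> C3 \<in> apollo_packing D \<and>
       tangent C1 C2 \<and> tangent C1 C3 \<and> tangent C2 C3 \<and>
       integral_ccc C1 \<and> integral_ccc C2 \<and> integral_ccc C3"
  then obtain C1 C2 C3 where C: "C1 \<in> apollo_packing D" "C2 \<in> apollo_packing D" "C3 \<in> apollo_packing D"
    and tan: "tangent C1 C2" "tangent C1 C3" "tangent C2 C3"
    and int: "integral_ccc C1" "integral_ccc C2" "integral_ccc C3" by blast
  \<comment> \<open>The orbit is restarted at \<open>E\<close>, since \<open>orbit_extend\<close>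
    wants the circles collected so far in the initial configuration.\<close>
  have ext: "\<exists>E' \<in> apollo_orbit D. insert c S \<subseteq> range E'"
    if E: "E \<in> apollo_orbit D" "S \<subseteq> range E" and c: "c \<in> apollo_packing D"
      and tan: "\<And>s. s \<in> S \<Longrightarrow> lor (cvec s) (cvec c) = -1" for c S E
  proof -
    obtain V k where V: "V \<in> apollo_orbit D" "c = V k"
      using c unfolding apollo_packing_def by blast
    then have "\<exists>E' \<in> apollo_orbit E. insert c S \<subseteq> range E'"
      using orbit_extend[OF des[OF E(1)] E(2) orb[OF E(1) V(1)]] tan by blast
    then show ?thesis using orbit_trans E(1) by blast
  qed
  obtain E1 where E1: "E1 \<in> apollo_orbit D" "{C1} \<subseteq> range E1"
    using ext[OF apollo_orbit.base _ C(1), of "{}"] by auto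
  obtain E2 where E2: "E2 \<in> apollo_orbit D" "{C2, C1} \<subseteq> range E2"
    using ext[OF E1 C(2)] m1[OF C(1,2) tan(1)] by auto
  obtain E where E: "E \<in> apollo_orbit D" "{C3, C2, C1} \<subseteq> range E"
    using ext[OF E2 C(3)] m1[OF C(1,3) tan(2)] m1[OF C(2,3) tan(3)] by auto
  then obtain i j k where ijk: "C1 = E i" "C2 = E j" "C3 = E k" by auto
  have "wf_circle (E i)" for i using des[OF E(1)] unfolding descartes_def by blast
  then have "i \<noteq> j" "i \<noteq> k" "j \<noteq> k" using tan not_tangent_self unfolding ijk by metis+
  have g: "gram (\<lambda>i. cvec (E i))" using des[OF E(1)] by (simp add: descartes_iff)
  have "integral_ccc (E l)" for l
  proof (cases "l \<in> {i, j, k}")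
    case True
    then show ?thesis using int ijk by auto
  next
    case False
    then have "distinct [i, j, k, l]" using \<open>i \<noteq> j\<close> \<open>i \<noteq> k\<close> \<open>j \<noteq> k\<close> by auto
    moreover have "cvec (E m) $ n \<in> \<int>" if "m \<in> {i, j, k}" "n \<in> {2, 3, 4}" for m n
      using that int unfolding ijk integral_ccc_iff by auto
    ultimately show ?thesis using fourth_integral[OF g] unfolding integral_ccc_iff by blast
  qed
  then show "strongly_integral D" unfolding strongly_integral_def using E(1) by blast
qed

end
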